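(* Let $(G,b,w)$ be an instance of SFP. If $(M,p)$ is a stable solution for $(G,b,w)$, then $M$ is a maximum weight $b$-matching of $G$ and the total payoff vector $p^t$ is a core allocation of the multiple partners matching game $(N,v)$ defined on $(G,b,w)$. Moreover, for every other maximum weight $b$-matching $\hat M$ of $G$ there exists a payoff vector $\hat p$ that is equivalent to $p$ and compatible with $\hat M$.
   Context: An instance of SFP (a multiple partners matching game) is a triple $(G,b,w)$ where $G=(N,E)$ is a finite undirected graph without loops or multiple edges, $b:N\to\mathbb{Z}_{\ge 0}$ is a vertex capacity function, and $w:E\to\mathbb{R}_{\ge 0}$ is an edge weighting. A set $M\subseteq E$ is a $b$-matching if every $i\in N$ is incident to at most $b(i)$ edges of $M$; its weight is $w(M)=\sum_{e\in M}w(e)$. A function $p:N\times N\to\mathbb{R}_{\ge 0}$ is a payoff vector compatible with $M$ if $p(i,j)+p(j,i)=w(ij)$ for all $ij\in M$ and $p(i,j)=p(j,i)=0$ for all $ij\notin M$. A pair $(M,p)$ with $M$ a $b$-matching and $p$ a payoff vector compatible with $M$ is a solution. The utility function $u_p:N\to\mathbb{R}_{\ge 0}$ is defined by $u_p(i)=\min\{p(i,j): ij\in M\}$ if $i$ is saturated by $M$, i.e. incident with $b(i)$ edges of $M$, and $u_p(i)=0$ otherwise. A solution $(M,p)$ is stable if $u_p(i)+u_p(j)\ge w(ij)$ for all $ij\in E\setminus M$. The total payoff vector $p^t\in\mathbb{R}^N$ is $p^t(i)=\sum_{j:ij\in E}p(i,j)$. The cooperative game $(N,v)$ defined on $(G,b,w)$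 has, for $S\subseteq N$, value $v(S)$ equal to the maximum weight of a $b$-matching in the induced subgraph $G[S]$ (and $0$ if $G[S]$ is edgeless). A core allocation is a vector $x\in\mathbb{R}^N$ with $\sum_{i\in N}x(i)=v(N)$ and $\sum_{i\in S}x(i)\ge v(S)$ for all nonempty $S\subseteq N$. Equivalence is defined for payoff vectors of stable solutions: if $(M,p)$ and $(\hat M,\hat p)$ are two stable solutions for $(G,b,w)$, then $p$ and $\hat p$ are equivalent if (1) $u_p(i)=u_{\hat p}(i)$ for every $i\in N$; (2) $p(i,j)=\hat p(i,j)$ and $p(j,i)=\hat p(j,i)$ for every $ij\in M\cap\hat M$; (3) $p(i,j)=u_p(i)=u_{\hat p}(i)$ and $p(j,i)=u_p(j)=u_{\hat p}(j)$ for every $ij\in M\setminus\hat M$; (4) $\hat p(i,j)=u_{\hat p}(i)=u_p(i)$ and $\hat p(j,i)=u_{\hat p}(j)=u_p(j)$ for every $ij\in\hat M\setminus M$. *)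

theory Defs
  imports Complex_Main
begin

text \<open>
  Simple graphs are given by a vertex set \<open>N\<close> and a set \<open>E\<close> of two-element subsets of \<open>N\<close>;
  the edge \<open>ij\<close> is \<open>{i, j}\<close>. Payoff vectors on \<open>N \<times> N\<close> are curried functions whose values
  outside \<open>N \<times> N\<close> are irrelevant.
\<close>

definition sfp_instance ::
    "'a set \<Rightarrow> 'a set set \<Rightarrow> ('a \<Rightarrow> nat) \<Rightarrow> ('a set \<Rightarrow> real) \<Rightarrow> bool" where
  "sfp_instance N E b w \<longleftrightarrow>
     finite N \<and> (\<forall>e\<in>E. e \<subseteq> N \<and> card e = 2) \<and> (\<forall>e\<in>E. w e \<ge> 0)"

definition b_matching :: "'a set \<Rightarrow> 'a set set \<Rightarrow> ('a \<Rightarrow> nat) \<Rightarrow> 'a set set \<Rightarrow> bool" where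
  "b_matching N E b M \<longleftrightarrow> M \<subseteq> E \<and> (\<forall>i\<in>N. card {e \<in> M. i \<in> e} \<le> b i)"

definition weight :: "('a set \<Rightarrow> real) \<Rightarrow> 'a set set \<Rightarrow> real" where
  "weight w M = (\<Sum>e\<in>M. w e)"

definition max_weight_b_matching ::
    "'a set \<Rightarrow> 'a set set \<Rightarrow> ('a \<Rightarrow> nat) \<Rightarrow> ('a set \<Rightarrow> real) \<Rightarrow> 'a set set \<Rightarrow> bool" where
  "max_weight_b_matching N E b w M \<longleftrightarrow>
     b_matching N E b M \<and> (\<forall>M'. b_matching N E b M' \<longrightarrow> weight w M' \<le> weight w M)"

definition compatible ::
    "'a set \<Rightarrow> ('a set \<Rightarrow> real) \<Rightarrow> 'a set set \<Rightarrow> ('a \<Rightarrow> 'a \<Rightarrow> real) \<Rightarrow> bool" where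
  "compatible N w M p \<longleftrightarrow>
     (\<forall>i\<in>N. \<forall>j\<in>N. p i j \<ge> 0) \<and>
     (\<forall>i\<in>N. \<forall>j\<in>N. {i, j} \<in> M \<longrightarrow> p i j + p j i = w {i, j}) \<and>
     (\<forall>i\<in>N. \<forall>j\<in>N. {i, j} \<notin> M \<longrightarrow> p i j = 0 \<and> p j i = 0)"

definition solution ::
    "'a set \<Rightarrow> 'a set set \<Rightarrow> ('a \<Rightarrow> nat) \<Rightarrow> ('a set \<Rightarrow> real) \<Rightarrow>
     'a set set \<Rightarrow> ('a \<Rightarrow> 'a \<Rightarrow> real) \<Rightarrow> bool" where
  "solution N E b w M p \<longleftrightarrow> b_matching N E b M \<and> compatible N w M p"

definition saturated :: "('a \<Rightarrow> nat) \<Rightarrow> 'a set set \<Rightarrow> 'a \<Rightarrow> bool" where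
  "saturated b M i \<longleftrightarrow> card {e \<in> M. i \<in> e} = b i"

text \<open>
  A vertex of capacity \<open>0\<close> is always saturated, and its utility is then the minimum of the
  empty set. The usual definition does not say what this is, so its value is a parameter \<open>c\<close>;
  \<open>c = 0\<close> gives one convention, and any \<open>c\<close> bounding all edge weights has the effect of
  \<open>min \<emptyset> = \<infinity>\<close> (an edge at such a vertex never blocks).
\<close>

definition utility ::
    "real \<Rightarrow> ('a \<Rightarrow> nat) \<Rightarrow> 'a set set \<Rightarrow> ('a \<Rightarrow> 'a \<Rightarrow> real) \<Rightarrow> 'a \<Rightarrow> real" where
  "utility c b M p i =
     (if saturated b M i
      then (if b i = 0 then c else Min {p i j | j. {i, j} \<in> M})
      else 0)"

definition stable_solution ::
    "real \<Rightarrow> 'a set \<Rightarrow> 'a set set \<Rightarrow> ('a \<Rightarrow> nat) \<Rightarrow> ('a set \<Rightarrow> real) \<Rightarrow>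
     'a set set \<Rightarrow> ('a \<Rightarrow> 'a \<Rightarrow> real) \<Rightarrow> bool" where
  "stable_solution c N E b w M p \<longleftrightarrow>
     solution N E b w M p \<and>
     (\<forall>i j. {i, j} \<in> E - M \<longrightarrow> utility c b M p i + utility c b M p j \<ge> w {i, j})"

definition total_payoff :: "'a set set \<Rightarrow> ('a \<Rightarrow> 'a \<Rightarrow> real) \<Rightarrow> 'a \<Rightarrow> real" where
  "total_payoff E p i = (\<Sum>j | {i, j} \<in> E. p i j)"

definition induced_edges :: "'a set set \<Rightarrow> 'a set \<Rightarrow> 'a set set" where
  "induced_edges E S = {e \<in> E. e \<subseteq> S}"

text \<open>If the induced subgraph is edgeless, its only b-matching is empty and the value is \<open>0\<close>.\<close>

definition game_value ::
    "'a set set \<Rightarrow> ('a \<Rightarrow> nat) \<Rightarrow> ('a set \<Rightarrow> real) \<Rightarrow> 'a set \<Rightarrow> real" where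
  "game_value E b w S = Max {weight w M | M. b_matching S (induced_edges E S) b M}"

definition core_allocation :: "'a set \<Rightarrow> ('a set \<Rightarrow> real) \<Rightarrow> ('a \<Rightarrow> real) \<Rightarrow> bool" where
  "core_allocation N v x \<longleftrightarrow>
     (\<Sum>i\<in>N. x i) = v N \<and> (\<forall>S. S \<subseteq> N \<and> S \<noteq> {} \<longrightarrow> (\<Sum>i\<in>S. x i) \<ge> v S)"

text \<open>Equivalence is a relation between the payoff vectors of two \<^emph>\<open>stable\<close> solutions.\<close>

definition equivalent_payoffs ::
    "real \<Rightarrow> 'a set \<Rightarrow> 'a set set \<Rightarrow> ('a \<Rightarrow> nat) \<Rightarrow> ('a set \<Rightarrow> real) \<Rightarrow>
     'a set set \<Rightarrow> ('a \<Rightarrow> 'a \<Rightarrow> real) \<Rightarrow> 'a set set \<Rightarrow> ('a \<Rightarrow> 'a \<Rightarrow> real) \<Rightarrow> bool" where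
  "equivalent_payoffs c N E b w M p M' p' \<longleftrightarrow>
     stable_solution c N E b w M p \<and> stable_solution c N E b w M' p' \<and>
     (\<forall>i\<in>N. utility c b M p i = utility c b M' p' i) \<and>
     (\<forall>i j. {i, j} \<in> M \<inter> M' \<longrightarrow> p i j = p' i j \<and> p j i = p' j i) \<and>
     (\<forall>i j. {i, j} \<in> M - M' \<longrightarrow>
        p i j = utility c b M p i \<and> utility c b M p i = utility c b M' p' i \<and>
        p j i = utility c b M p j \<and> utility c b M p j = utility c b M' p' j) \<and>
     (\<forall>i j. {i, j} \<in> M' - M \<longrightarrow>
        p' i j = utility c b M' p' i \<and> utility c b M' p' i = utility c b M p i \<and>
        p' j i = utility c b M' p' j \<and> utility c b M' p' j = utility c b M p j)"

end

theory Submission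
  imports Defs
begin

text \<open>
  Write \<open>u\<close> for the utility of the stable solution \<open>(M, p)\<close>. On an edge of \<open>M\<close> one has
  \<open>u i \<le> p i j\<close>, and on an edge outside \<open>M\<close> stability gives \<open>w {i, j} \<le> u i + u j\<close>. Given a
  \<open>b\<close>-matching \<open>M'\<close>, let every vertex ask for \<open>p i j\<close> on edges of \<open>M' \<inter> M\<close> and for \<open>u i\<close>
  on edges of \<open>M' - M\<close>. These demands cover \<open>w\<close> on \<open>M'\<close>, and at each vertex they do not
  exceed the total payoff: either \<open>u i = 0\<close> or \<open>M\<close> saturates \<open>i\<close>, so that \<open>M' - M\<close> has at most
  as many edges at \<open>i\<close> as \<open>M - M'\<close>. Summing over a coalition gives the core inequalities,
  and over \<open>N\<close> the optimality of \<open>M\<close>. If \<open>M'\<close> has maximum weight, all these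
  inequalities are tight, and the demands themselves are the equivalent payoff vector.
\<close>

section \<open>Minima and demands at a single vertex, as sums over finite sets\<close>

lemma Min_image_eqI:
  assumes "finite B" "k \<in> B" "f k = m" "\<And>j. j \<in> B \<Longrightarrow> m \<le> f j"
  shows "Min (f ` B) = (m :: 'b :: linorder)"
  using assms by (intro Min_eqI) auto

text \<open>In use, \<open>A\<close> and \<open>B\<close> are the neighbourhoods of one vertex in
  two matchings. The terms on \<open>A \<inter> B\<close> cancel; charging \<open>u\<close> for
  every element of \<open>A - B\<close> as well leaves a multiple
  \<open>card (A - B) - card (B - A) = card A - card B\<close> of \<open>u\<close>.\<close>

lemma demand_slack:
  fixes p :: "'a \<Rightarrow> real"
  assumes "finite A" "finite B"
  shows "(\<Sum>j\<in>A. p j) - (\<Sum>j\<in>B. if j \<in> A then p j else u) =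
    (\<Sum>j\<in>A - B. p j - u) + (real (card A) - real (card B)) * u"
proof -
  have A: "(\<Sum>j\<in>A. p j) = (\<Sum>j\<in>A - B. p j) + (\<Sum>j\<in>A \<inter> B. p j)"
    using sum.Int_Diff[OF assms(1), of p B] by simp
  have "(\<Sum>j\<in>B. if j \<in> A then p j else u) = (\<Sum>j\<in>B \<inter> A. p j) + (\<Sum>j\<in>B - A. u)"
    using sum.Int_Diff[OF assms(2), of "\<lambda>j. if j \<in> A then p j else u" A] by simp
  moreover have "card A = card (A \<inter> B) + card (A - B)" "card B = card (A \<inter> B) + card (B - A)"
    using sum.Int_Diff[OF assms(1), of "\<lambda>_. 1 :: nat" B]
      sum.Int_Diff[OF assms(2), of "\<lambda>_. 1 :: nat" A]
    by (simp_all add: Int_commute)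
  ultimately show ?thesis
    using A by (simp add: sum_subtractf algebra_simps Int_commute)
qed

text \<open>Both summands of the slack are nonnegative: the first termwise, the second because
  \<open>u = 0\<close> or \<open>card A = b \<ge> card B\<close>. Hence equality makes both vanish,
  and each vanishing summand gives one conjunct.\<close>

lemma
  fixes p :: "'a \<Rightarrow> real" and b :: nat
  assumes fin: "finite A" "finite B"
    and p: "\<And>j. j \<in> A \<Longrightarrow> u \<le> p j" and u: "0 \<le> u" "u = 0 \<or> card A = b" and B: "card B \<le> b"
  shows demand_le: "(\<Sum>j\<in>B. if j \<in> A then p j else u) \<le> (\<Sum>j\<in>A. p j)"
    and demand_eqD: "(\<Sum>j\<in>B. if j \<in> A then p j else u) = (\<Sum>j\<in>A. p j) \<Longrightarrow>
      (\<forall>j\<in>A - B. p j = u) \<and> (u = 0 \<or> card B = b)"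
proof -
  have nonneg: "0 \<le> (\<Sum>j\<in>A - B. p j - u)" "0 \<le> (real (card A) - real (card B)) * u"
    using p u B by (auto intro!: sum_nonneg)
  show "(\<Sum>j\<in>B. if j \<in> A then p j else u) \<le> (\<Sum>j\<in>A. p j)"
    using demand_slack[OF fin, of p u] nonneg by linarith
  assume "(\<Sum>j\<in>B. if j \<in> A then p j else u) = (\<Sum>j\<in>A. p j)"
  then have "(\<Sum>j\<in>A - B. p j - u) = 0" "(real (card A) - real (card B)) * u = 0"
    using demand_slack[OF fin, of p u] nonneg by linarith+
  moreover from this(1) have "\<forall>j\<in>A - B. p j - u = 0"
    using fin(1) p by (subst (asm) sum_nonneg_eq_0_iff) auto
  ultimately show "(\<forall>j\<in>A - B. p j = u) \<and> (u = 0 \<or> card B = b)"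
    using u(2) by auto
qed

section \<open>Neighbourhoods and double counting of incidences\<close>

definition neighbours :: "'a set set \<Rightarrow> 'a \<Rightarrow> 'a set" where
  "neighbours F i = {j. {i, j} \<in> F}"

lemma mem_neighbours [simp]: "j \<in> neighbours F i \<longleftrightarrow> {i, j} \<in> F"
  by (simp add: neighbours_def)

lemma bij_betw_neighbours:
  assumes "\<forall>e\<in>F. card e = 2"
  shows "bij_betw (\<lambda>j. {i, j}) (neighbours F i) {e \<in> F. i \<in> e}"
proof (rule bij_betw_imageI)
  show "inj_on (\<lambda>j. {i, j}) (neighbours F i)"
    by (auto simp: inj_on_def doubleton_eq_iff)
  show "(\<lambda>j. {i, j}) ` neighbours F i = {e \<in> F. i \<in> e}"
  proof (intro equalityI subsetI)
    fix e assume e: "e \<in> {e \<in> F. i \<in> e}"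
    then obtain x y where "e = {x, y}"
      using assms by (auto simp: card_2_iff)
    then have "e = {i, if x = i then y else x}"
      using e by auto
    then show "e \<in> (\<lambda>j. {i, j}) ` neighbours F i"
      using e by (metis (no_types, lifting) image_eqI mem_Collect_eq mem_neighbours)
  qed auto
qed

text \<open>The inner sum runs over a singleton when \<open>e\<close> is an edge and
  \<open>i\<close> one of its ends; this form avoids choosing an order of the two ends.\<close>

definition edge_sum :: "('a \<Rightarrow> 'a \<Rightarrow> real) \<Rightarrow> 'a set \<Rightarrow> real" where
  "edge_sum f e = (\<Sum>i\<in>e. \<Sum>j\<in>e - {i}. f i j)"

lemma edge_sum_doubleton: "i \<noteq> j \<Longrightarrow> edge_sum f {i, j} = f i j + f j i"
  by (simp add: edge_sum_def insert_Diff_if)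

text \<open>Double counting of the incident pairs of a vertex and an edge.\<close>

lemma sum_neighbours:
  assumes "finite S" "finite F" "\<forall>e\<in>F. card e = 2 \<and> e \<subseteq> S"
  shows "(\<Sum>i\<in>S. \<Sum>j\<in>neighbours F i. f i j) = (\<Sum>e\<in>F. edge_sum f e)"
proof -
  have "(\<Sum>j\<in>neighbours F i. f i j) = (\<Sum>e | e \<in> F \<and> i \<in> e. \<Sum>j\<in>e - {i}. f i j)" for i
  proof -
    \<comment> \<open>Rewritten like this, the summand depends on \<open>j\<close> only through the
      edge \<open>{i, j}\<close>, so the sum can be reindexed by edges.\<close>
    have "(\<Sum>j\<in>neighbours F i. f i j) = (\<Sum>j\<in>neighbours F i. \<Sum>k\<in>{i, j} - {i}. f i k)"
    proof (rule sum.cong)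
      fix j assume "j \<in> neighbours F i"
      then have "{i, j} - {i} = {j}"
        using assms(3) by force
      then show "f i j = (\<Sum>k\<in>{i, j} - {i}. f i k)"
        by simp
    qed simp
    also have "\<dots> = (\<Sum>e | e \<in> F \<and> i \<in> e. \<Sum>j\<in>e - {i}. f i j)"
      using assms(3) by (intro sum.reindex_bij_betw[OF bij_betw_neighbours]) auto
    finally show ?thesis .
  qed
  then have "(\<Sum>i\<in>S. \<Sum>j\<in>neighbours F i. f i j) =
      (\<Sum>i\<in>S. \<Sum>e | e \<in> F \<and> i \<in> e. \<Sum>j\<in>e - {i}. f i j)"
    by simp
  also have "\<dots> = (\<Sum>e\<in>F. \<Sum>i | i \<in> S \<and> i \<in> e. \<Sum>j\<in>e - {i}. f i j)"
    by (rule sum.swap_restrict[OF assms(1,2)])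
  also have "\<dots> = (\<Sum>e\<in>F. edge_sum f e)"
    unfolding edge_sum_def using assms(3) by (intro sum.cong) auto
  finally show ?thesis .
qed

section \<open>Utilities and demands of a stable solution\<close>

locale stable_sfp =
  fixes N :: "'a set" and E :: "'a set set" and b :: "'a \<Rightarrow> nat" and w :: "'a set \<Rightarrow> real"
    and M :: "'a set set" and p :: "'a \<Rightarrow> 'a \<Rightarrow> real" and c :: real
  assumes inst: "sfp_instance N E b w"
    and c: "0 \<le> c"
    and stable: "stable_solution c N E b w M p"
begin

abbreviation u :: "'a \<Rightarrow> real" where
  "u \<equiv> utility c b M p"

definition demand :: "'a \<Rightarrow> 'a \<Rightarrow> real" where
  "demand i j = (if {i, j} \<in> M then p i j else u i)"

lemma finite_N: "finite N"
  using inst by (simp add: sfp_instance_def)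

lemma finite_E: "finite E"
  using inst by (auto simp: sfp_instance_def intro: finite_subset[of E "Pow N"])

lemma edgeD: "e \<in> E \<Longrightarrow> card e = 2 \<and> e \<subseteq> N"
  using inst by (simp add: sfp_instance_def)

lemma edge_vertices:
  assumes "{i, j} \<in> E"
  shows "i \<in> N" "j \<in> N" "i \<noteq> j"
  using edgeD[OF assms] by (auto simp: card_2_iff)

lemma b_matching_M: "b_matching N E b M"
  using stable by (simp add: stable_solution_def solution_def)

lemma M_subset: "M \<subseteq> E"
  using b_matching_M by (simp add: b_matching_def)

lemma finite_neighbours: "F \<subseteq> E \<Longrightarrow> finite (neighbours F i)"
  using edge_vertices(2) by (intro finite_subset[OF _ finite_N]) auto

lemma degree_eq: "F \<subseteq> E \<Longrightarrow> card {e \<in> F. i \<in> e} = card (neighbours F i)"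
  using edgeD by (intro bij_betw_same_card[OF bij_betw_neighbours, symmetric]) auto

lemma saturated_iff: "F \<subseteq> E \<Longrightarrow> saturated b F i \<longleftrightarrow> card (neighbours F i) = b i"
  by (simp add: saturated_def degree_eq)

lemma utility_eq:
  "F \<subseteq> E \<Longrightarrow> utility c b F q i =
    (if card (neighbours F i) = b i
     then (if b i = 0 then c else Min (q i ` neighbours F i)) else 0)"
  by (auto simp: utility_def saturated_iff intro!: arg_cong[where f = Min])

lemma b_matching_iff:
  "b_matching S (induced_edges E S) b F \<longleftrightarrow>
    F \<subseteq> E \<and> (\<forall>e\<in>F. e \<subseteq> S) \<and> (\<forall>i\<in>S. card (neighbours F i) \<le> b i)"
proof (cases "F \<subseteq> E")
  case True
  then show ?thesis
    by (auto simp: b_matching_def induced_edges_def degree_eq)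
qed (auto simp: b_matching_def induced_edges_def)

lemma induced_edges_N: "induced_edges E N = E"
  using edgeD by (auto simp: induced_edges_def)

lemma
  assumes "i \<in> N" "j \<in> N"
  shows p_nonneg: "0 \<le> p i j"
    and p_add: "{i, j} \<in> M \<Longrightarrow> p i j + p j i = w {i, j}"
    and p_eq_0: "{i, j} \<notin> M \<Longrightarrow> p i j = 0"
  using stable assms by (auto simp: stable_solution_def solution_def compatible_def)

lemma stableD: "{i, j} \<in> E \<Longrightarrow> {i, j} \<notin> M \<Longrightarrow> w {i, j} \<le> u i + u j"
  using stable by (auto simp: stable_solution_def)

lemma card_neighbours_M: "i \<in> N \<Longrightarrow> card (neighbours M i) \<le> b i"
  using b_matching_M M_subset by (simp add: b_matching_def degree_eq)

lemma p_ge_u: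
  assumes "{i, j} \<in> M"
  shows "u i \<le> p i j"
proof -
  have ij: "i \<in> N" "j \<in> N"
    using assms M_subset edge_vertices by auto
  have "j \<in> neighbours M i"
    using assms by simp
  moreover have fin: "finite (neighbours M i)"
    by (rule finite_neighbours[OF M_subset])
  \<comment> \<open>An \<open>M\<close>-edge at \<open>i\<close> forces positive capacity, so the
    default \<open>c\<close> cannot be the value of \<open>u i\<close>.\<close>
  ultimately have "card (neighbours M i) \<noteq> 0"
    by auto
  then have "b i \<noteq> 0"
    using card_neighbours_M[OF ij(1)] by simp
  then show ?thesis
    using assms fin p_nonneg[OF ij] by (auto simp: utility_eq[OF M_subset])
qed

lemma u_nonneg:
  assumes "i \<in> N"
  shows "0 \<le> u i"
proof (cases "card (neighbours M i) = b i \<and> b i \<noteq> 0")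
  case True
  then have "neighbours M i \<noteq> {}"
    by auto
  moreover have "0 \<le> p i j" if "j \<in> neighbours M i" for j
    using that assms M_subset edge_vertices p_nonneg by auto
  ultimately show ?thesis
    using True finite_neighbours[OF M_subset] by (simp add: utility_eq[OF M_subset])
\<comment> \<open>What remains is an unsaturated vertex, of utility \<open>0\<close>, or one of
  capacity \<open>0\<close>, where \<open>u i = c \<ge> 0\<close>.\<close>
qed (use c in \<open>auto simp: utility_eq[OF M_subset]\<close>)

lemma u_eq_0_or_saturated: "u i = 0 \<or> card (neighbours M i) = b i"
  by (simp add: utility_eq[OF M_subset])

lemma total_payoff_eq:
  assumes "i \<in> N"
  shows "total_payoff E p i = (\<Sum>j\<in>neighbours M i. p i j)"
  unfolding total_payoff_def neighbours_def[symmetric]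
  using assms M_subset edge_vertices p_eq_0 finite_neighbours[of E]
  by (intro sum.mono_neutral_right) auto

text \<open>The single-vertex comparison with \<open>neighbours M i\<close> as \<open>A\<close> and
  \<open>neighbours F i\<close> as \<open>B\<close>.\<close>

lemma
  assumes "i \<in> N" "F \<subseteq> E" "card (neighbours F i) \<le> b i"
  shows demand_le_total: "(\<Sum>j\<in>neighbours F i. demand i j) \<le> total_payoff E p i"
    and demand_eq_totalD: "(\<Sum>j\<in>neighbours F i. demand i j) = total_payoff E p i \<Longrightarrow>
      (\<forall>j. {i, j} \<in> M - F \<longrightarrow> p i j = u i) \<and> (u i = 0 \<or> card (neighbours F i) = b i)"
proof -
  note hyps = finite_neighbours[OF M_subset, of i] finite_neighbours[OF assms(2), of i]
    p_ge_u[of i] u_nonneg[OF assms(1)] u_eq_0_or_saturated[of i] assms(3)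
  have eq: "(\<Sum>j\<in>neighbours F i. demand i j) =
      (\<Sum>j\<in>neighbours F i. if j \<in> neighbours M i then p i j else u i)"
    by (simp add: demand_def)
  show "(\<Sum>j\<in>neighbours F i. demand i j) \<le> total_payoff E p i"
    unfolding eq total_payoff_eq[OF assms(1)] by (rule demand_le) (use hyps in auto)
  assume "(\<Sum>j\<in>neighbours F i. demand i j) = total_payoff E p i"
  then have "(\<forall>j\<in>neighbours M i - neighbours F i. p i j = u i) \<and>
      (u i = 0 \<or> card (neighbours F i) = b i)"
    unfolding eq total_payoff_eq[OF assms(1)] by (intro demand_eqD) (use hyps in auto)
  then show "(\<forall>j. {i, j} \<in> M - F \<longrightarrow> p i j = u i) \<and> (u i = 0 \<or> card (neighbours F i) = b i)"
    by auto
qed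

lemma edge_sum_demand:
  assumes "{i, j} \<in> E"
  shows "edge_sum demand {i, j} = (if {i, j} \<in> M then w {i, j} else u i + u j)"
  using edge_vertices[OF assms] p_add[of i j]
  by (simp add: edge_sum_doubleton demand_def insert_commute)

section \<open>Core inequalities and optimality of \<open>M\<close>\<close>

lemma weight_le_edge_sum: "e \<in> E \<Longrightarrow> w e \<le> edge_sum demand e"
  using edgeD[of e] stableD by (auto simp: card_2_iff edge_sum_demand)

lemma sum_demand:
  assumes "S \<subseteq> N" "F \<subseteq> E" "\<forall>e\<in>F. e \<subseteq> S"
  shows "(\<Sum>i\<in>S. \<Sum>j\<in>neighbours F i. demand i j) = (\<Sum>e\<in>F. edge_sum demand e)"
  using assms finite_N finite_E edgeD by (intro sum_neighbours) (auto intro: finite_subset)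

lemma weight_le_total_payoff:
  assumes "S \<subseteq> N" "b_matching S (induced_edges E S) b F"
  shows "weight w F \<le> (\<Sum>i\<in>S. total_payoff E p i)"
proof -
  have F: "F \<subseteq> E" "\<forall>e\<in>F. e \<subseteq> S" "\<forall>i\<in>S. card (neighbours F i) \<le> b i"
    using assms(2) by (simp_all add: b_matching_iff)
  have "weight w F \<le> (\<Sum>e\<in>F. edge_sum demand e)"
    unfolding weight_def using F weight_le_edge_sum by (intro sum_mono) auto
  also have "\<dots> = (\<Sum>i\<in>S. \<Sum>j\<in>neighbours F i. demand i j)"
    using sum_demand assms F by simp
  also have "\<dots> \<le> (\<Sum>i\<in>S. total_payoff E p i)"
    using assms F by (intro sum_mono demand_le_total) auto
  finally show ?thesis .
qed

text \<open>On edges of \<open>M\<close> the demands are the payoffs \<open>p\<close>, so no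
  inequality is lost.\<close>

lemma weight_M: "weight w M = (\<Sum>i\<in>N. total_payoff E p i)"
proof -
  have "w e = edge_sum demand e" if "e \<in> M" for e
  proof -
    have "e \<in> E"
      using that M_subset by auto
    then show ?thesis
      using that edgeD[of e] by (auto simp: card_2_iff edge_sum_demand)
  qed
  then have "weight w M = (\<Sum>e\<in>M. edge_sum demand e)"
    by (simp add: weight_def)
  also have "\<dots> = (\<Sum>i\<in>N. \<Sum>j\<in>neighbours M i. demand i j)"
    using M_subset edgeD by (intro sum_demand[symmetric]) auto
  also have "\<dots> = (\<Sum>i\<in>N. total_payoff E p i)"
    by (simp add: total_payoff_eq demand_def)
  finally show ?thesis .
qed

lemma max_weight_M: "max_weight_b_matching N E b w M"
  using weight_le_total_payoff[of N] b_matching_M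
  by (simp add: max_weight_b_matching_def weight_M induced_edges_N)

lemma core_allocation_total_payoff:
  "core_allocation N (game_value E b w) (total_payoff E p)"
proof -
  let ?W = "\<lambda>S. {weight w F | F. b_matching S (induced_edges E S) b F}"
  have fin: "finite (?W S)" for S
    by (rule finite_subset[of _ "weight w ` Pow E"]) (auto simp: b_matching_iff finite_E)
  \<comment> \<open>The empty matching is always available.\<close>
  have ne: "?W S \<noteq> {}" for S
    using b_matching_iff[of S "{}"] by (auto simp: neighbours_def)
  have "game_value E b w N = weight w M"
    unfolding game_value_def using fin[of N] max_weight_M
    by (intro Max_eqI) (auto simp: max_weight_b_matching_def induced_edges_N)
  moreover have "game_value E b w S \<le> (\<Sum>i\<in>S. total_payoff E p i)" if "S \<subseteq> N" for S
    unfolding game_value_def using fin ne weight_le_total_payoff[OF that]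
    by (intro Max.boundedI) auto
  ultimately show ?thesis
    by (simp add: core_allocation_def weight_M)
qed

section \<open>Transfer of the payoffs to a maximum weight matching \<open>M'\<close>\<close>

context
  fixes M' :: "'a set set"
  assumes max': "max_weight_b_matching N E b w M'"
begin

definition demand' :: "'a \<Rightarrow> 'a \<Rightarrow> real" where
  "demand' i j = (if {i, j} \<in> M' then demand i j else 0)"

lemma b_matching_M': "b_matching N E b M'"
  using max' by (simp add: max_weight_b_matching_def)

lemma M'_subset: "M' \<subseteq> E"
  using b_matching_M' by (simp add: b_matching_def)

lemma card_neighbours_M': "i \<in> N \<Longrightarrow> card (neighbours M' i) \<le> b i"
  using b_matching_M' M'_subset by (simp add: b_matching_def degree_eq)

lemma weight_M': "weight w M' = (\<Sum>i\<in>N. total_payoff E p i)"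
  using max' max_weight_M weight_M
  by (auto simp: max_weight_b_matching_def intro!: antisym)

text \<open>The weight of \<open>M'\<close> is at most the sum of all demands on \<open>M'\<close>,
  which is at most the sum of all total payoffs, which is again the weight of \<open>M'\<close>.
  Both inequalities are sums of termwise ones, so each term is tight.\<close>

lemma
  shows weight_eq_edge_sum: "e \<in> M' \<Longrightarrow> w e = edge_sum demand e"
    and demand_eq_total:
      "i \<in> N \<Longrightarrow> (\<Sum>j\<in>neighbours M' i. demand i j) = total_payoff E p i"
proof -
  have fin: "finite M'"
    using M'_subset finite_E by (rule finite_subset)
  have le1: "\<And>e. e \<in> M' \<Longrightarrow> w e \<le> edge_sum demand e"
    using weight_le_edge_sum M'_subset by auto
  have le2: "\<And>i. i \<in> N \<Longrightarrow> (\<Sum>j\<in>neighbours M' i. demand i j) \<le> total_payoff E p i"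
    using demand_le_total M'_subset card_neighbours_M' by auto
  have eq: "(\<Sum>i\<in>N. \<Sum>j\<in>neighbours M' i. demand i j) = (\<Sum>e\<in>M'. edge_sum demand e)"
    using sum_demand[of N M'] M'_subset edgeD by auto
  have "(\<Sum>e\<in>M'. w e) = (\<Sum>e\<in>M'. edge_sum demand e)"
    "(\<Sum>i\<in>N. \<Sum>j\<in>neighbours M' i. demand i j) = (\<Sum>i\<in>N. total_payoff E p i)"
    using sum_mono[of M' w "edge_sum demand", OF le1]
      sum_mono[of N "\<lambda>i. \<Sum>j\<in>neighbours M' i. demand i j" "total_payoff E p", OF le2] eq weight_M'
    unfolding weight_def by linarith+
  then show "e \<in> M' \<Longrightarrow> w e = edge_sum demand e"
    "i \<in> N \<Longrightarrow> (\<Sum>j\<in>neighbours M' i. demand i j) = total_payoff E p i"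
    using sum_mono_inv[of w M' "edge_sum demand" e] le1 fin
      sum_mono_inv[of "\<lambda>i. \<Sum>j\<in>neighbours M' i. demand i j" N "total_payoff E p" i] le2 finite_N
    by auto
qed

lemma p_eq_u: "{i, j} \<in> M - M' \<Longrightarrow> p i j = u i"
  using demand_eq_totalD[OF _ M'_subset card_neighbours_M' demand_eq_total] M_subset
    edge_vertices by blast

lemma u_eq_0_or_saturated': "i \<in> N \<Longrightarrow> u i = 0 \<or> card (neighbours M' i) = b i"
  using demand_eq_totalD[OF _ M'_subset card_neighbours_M' demand_eq_total] by blast

lemma demand_add:
  assumes "{i, j} \<in> M'"
  shows "demand i j + demand j i = w {i, j}"
  using weight_eq_edge_sum[OF assms] assms M'_subset edge_vertices(3)[of i j]
  by (auto simp: edge_sum_doubleton)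

lemma compatible_demand': "compatible N w M' demand'"
  unfolding compatible_def demand'_def using demand_add p_nonneg u_nonneg
  by (auto simp: insert_commute) (auto simp: demand_def insert_commute)

text \<open>No demand on \<open>M'\<close> lies below \<open>u i\<close>, so at a saturated vertex
  of positive capacity it suffices that some \<open>M'\<close>-edge attains
  \<open>u i\<close>.\<close>

lemma utility_demand':
  assumes i: "i \<in> N"
  shows "utility c b M' demand' i = u i"
proof (cases "card (neighbours M' i) = b i \<and> b i \<noteq> 0")
  case True
  have fin: "finite (neighbours M i)" "finite (neighbours M' i)"
    using finite_neighbours M_subset M'_subset by auto
  have "\<exists>k\<in>neighbours M' i. demand' i k = u i"
  proof (cases "neighbours M' i \<subseteq> neighbours M i")
    \<comment> \<open>Any edge of \<open>M' - M\<close> at \<open>i\<close> has demand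
      \<open>u i\<close>.\<close>
    case False
    then show ?thesis
      by (auto simp: demand'_def demand_def)
  next
    case sub: True
    \<comment> \<open>The inclusion is an equality since
      \<open>card (neighbours M i) \<le> b i = card (neighbours M' i)\<close>. The minimum defining
      \<open>u i\<close> is then attained on \<open>M'\<close> too.\<close>
    then have eq: "neighbours M' i = neighbours M i"
      using fin(1) True card_neighbours_M[OF i] by (intro card_seteq) auto
    have "neighbours M i \<noteq> {}"
      using True eq by auto
    then have "Min (p i ` neighbours M i) \<in> p i ` neighbours M i"
      using fin by (intro Min_in) auto
    then have "u i \<in> p i ` neighbours M i"
      using True eq by (simp add: utility_eq[OF M_subset])
    then obtain k where k: "k \<in> neighbours M i" "p i k = u i"
      by auto
    moreover have "k \<in> neighbours M' i"
      using k(1) eq by blast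
    ultimately show ?thesis
      by (intro bexI[of _ k]) (simp_all add: demand'_def demand_def)
  qed
  then obtain k where "k \<in> neighbours M' i" "demand' i k = u i" ..
  moreover have "u i \<le> demand' i j" if "j \<in> neighbours M' i" for j
    using that p_ge_u by (simp add: demand'_def demand_def)
  ultimately have "Min (demand' i ` neighbours M' i) = u i"
    using fin by (intro Min_image_eqI) auto
  then show ?thesis
    using True by (simp add: utility_eq[OF M'_subset])
next
  case False
  \<comment> \<open>A vertex not saturated by \<open>M'\<close> has \<open>u i = 0\<close> by
    tightness; at capacity \<open>0\<close> both utilities are \<open>c\<close>.\<close>
  then consider "card (neighbours M' i) \<noteq> b i" | "b i = 0"
    by blast
  then show ?thesis
  proof cases
    case 1
    then show ?thesis
      using u_eq_0_or_saturated'[OF i] by (simp add: utility_eq[OF M'_subset])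
  next
    case 2
    then show ?thesis
      using card_neighbours_M[OF i] card_neighbours_M'[OF i]
      by (simp add: utility_eq[OF M_subset] utility_eq[OF M'_subset])
  qed
qed

lemma stable_demand': "stable_solution c N E b w M' demand'"
proof -
  have "w {i, j} \<le> u i + u j" if "{i, j} \<in> E - M'" for i j
  \<comment> \<open>Edges outside both matchings inherit stability from \<open>(M, p)\<close>. On
    \<open>M - M'\<close> tightness makes both payoffs equal to the utilities, so
    \<open>w {i, j} = u i + u j\<close>.\<close>
  proof (cases "{i, j} \<in> M")
    case True
    then have "p i j = u i" "p j i = u j"
      using that p_eq_u[of i j] p_eq_u[of j i] by (auto simp: insert_commute)
    then show ?thesis
      using p_add[of i j] True that edge_vertices[of i j] by simp
  qed (use that stableD in auto)
  moreover have "utility c b M' demand' i = u i" "utility c b M' demand' j = u j"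
    if "{i, j} \<in> E - M'" for i j
    using that edge_vertices[of i j] utility_demand' by auto
  ultimately show ?thesis
    by (auto simp: stable_solution_def solution_def b_matching_M' compatible_demand')
qed

lemma equivalent_demand': "equivalent_payoffs c N E b w M p M' demand'"
proof -
  have utility: "utility c b M' demand' i = u i" "utility c b M' demand' j = u j"
    if "{i, j} \<in> M \<union> M'" for i j
    using that M_subset M'_subset edge_vertices[of i j] utility_demand' by auto
  show ?thesis
    unfolding equivalent_payoffs_def
  proof (intro conjI allI impI ballI)
    fix i j assume ij: "{i, j} \<in> M - M'"
    then have ji: "{j, i} \<in> M - M'"
      by (simp add: insert_commute)
    show "p i j = u i" "p j i = u j"
      using p_eq_u[OF ij] p_eq_u[OF ji] .
    show "u i = utility c b M' demand' i" "u j = utility c b M' demand' j"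
      using utility[of i j] ij by auto
  next
    fix i j assume ij: "{i, j} \<in> M' - M"
    then have ji: "{j, i} \<in> M' - M"
      by (simp add: insert_commute)
    show u: "utility c b M' demand' i = u i" "utility c b M' demand' j = u j"
      using utility[of i j] ij by auto
    show "demand' i j = utility c b M' demand' i" "demand' j i = utility c b M' demand' j"
      using ij ji by (simp_all add: u demand'_def demand_def)
  qed (auto simp: stable stable_demand' utility_demand' demand'_def demand_def insert_commute)
qed

end

end

theorem theorem7:
  fixes N :: "'a set" and E :: "'a set set" and b :: "'a \<Rightarrow> nat" and w :: "'a set \<Rightarrow> real"
    and M :: "'a set set" and p :: "'a \<Rightarrow> 'a \<Rightarrow> real" and c :: real
  assumes "sfp_instance N E b w"
    and "c \<ge> 0"
    and "stable_solution c N E b w M p"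
  shows "max_weight_b_matching N E b w M
       \<and> core_allocation N (game_value E b w) (total_payoff E p)
       \<and> (\<forall>M'. max_weight_b_matching N E b w M' \<and> M' \<noteq> M \<longrightarrow>
            (\<exists>p'. compatible N w M' p' \<and> equivalent_payoffs c N E b w M p M' p'))"
proof -
  interpret stable_sfp N E b w M p c
    using assms by unfold_locales
  show ?thesis
    using max_weight_M core_allocation_total_payoff compatible_demand' equivalent_demand'
    by blast
qed

end
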